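(* Let $\mathcal{X},\mathcal{Y}$ be finite sets, $(X,Y)$ random variables on $\mathcal{X}\times\mathcal{Y}$ with joint distribution $p_{XY}$, and $f:\mathcal{X}\times\mathcal{Y}\to\mathcal{Z}$ a function. If $p_{XY}(x,y)>0$ for all $(x,y)\in\mathcal{X}\times\mathcal{Y}$, then for any zero-error scheme (of any length $n$) the relay can compute the function: for a zero-error scheme with encoding functions $\phi_A,\phi_B,\phi_C$, the values $f(x_i,y_i)$, $i=1,\dots,n$, are determined by $(\phi_A(x^n),\phi_B(y^n))$ for all $(x^n,y^n)\in\mathcal{X}^n\times\mathcal{Y}^n$; i.e. there is a function $g$ with $g(\phi_A(x^n),\phi_B(y^n))=(f(x_1,y_1),\dots,f(x_n,y_n))$ for all $(x^n,y^n)\in\mathcal{X}^n\times\mathcal{Y}^n$.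
   Context: Nodes A and B observe $x^n\in\mathcal{X}^n$ and $y^n\in\mathcal{Y}^n$ and send messages to a relay, which receives both messages and broadcasts a message to A and B. The support set is $S_{XY}=\{(x,y): p_{XY}(x,y)>0\}$. A length-$n$ scheme is a quintuple $(\phi_A,\phi_B,\phi_C,\psi_A,\psi_B)$ with prefix-free encoding functions (the set of values taken by each is a prefix-free code) $\phi_A:\mathcal{X}^n\to\{0,1\}^*$, $\phi_B:\mathcal{Y}^n\to\{0,1\}^*$, $\phi_C:\phi_A(\mathcal{X}^n)\times\phi_B(\mathcal{Y}^n)\to\{0,1\}^*$ ($\{0,1\}^*$ is the set of finite binary strings), and decoding functions $\psi_A:\mathcal{X}^n\times \mathrm{Im}(\phi_C)\to\mathcal{Z}^n$, $\psi_B:\mathcal{Y}^n\times\mathrm{Im}(\phi_C)\to\mathcal{Z}^n$. It is a zero-error scheme if for every $x^n\in\mathcal{X}^n$, $y^n\in\mathcal{Y}^n$ and every $i$ with $(x_i,y_i)\in S_{XY}$, the $i$-th components of $\psi_A(x^n,\phi_C(\phi_A(x^n),\phi_B(y^n)))$ and of $\psi_B(y^n,\phi_C(\phi_A(x^n),\phi_B(y^n)))$ both equal $f(x_i,y_i)$. *)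

theory Defs
  imports "HOL-Probability.Probability" "HOL-Library.Sublist" "HOL-Library.NList"
begin

definition joint_prob :: "'s measure \<Rightarrow> ('s \<Rightarrow> 'x) \<Rightarrow> ('s \<Rightarrow> 'y) \<Rightarrow> 'x \<times> 'y \<Rightarrow> real"
  where "joint_prob M X Y = (\<lambda>(x, y). \<P>(\<omega> in M. X \<omega> = x \<and> Y \<omega> = y))"

definition support_set :: "'x set \<Rightarrow> 'y set \<Rightarrow> ('x \<times> 'y \<Rightarrow> real) \<Rightarrow> ('x \<times> 'y) set"
  where "support_set \<X> \<Y> p = {(x, y) \<in> \<X> \<times> \<Y>. p (x, y) > 0}"

definition prefix_free :: "bool list set \<Rightarrow> bool"
  where "prefix_free C \<longleftrightarrow> (\<forall>u\<in>C. \<forall>v\<in>C. prefix u v \<longrightarrow> u = v)"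

text \<open>
  Words in \<open>\<X>\<^sup>n\<close> are lists in \<open>nlists n \<X>\<close>, with components indexed from \<open>0\<close>.
  HOL functions are total, so domains and codomains are imposed by membership in
  \<open>A \<rightarrow> B\<close>; the encoders need no such condition on their codomain, which is the
  whole type of binary strings.
\<close>

definition relay_image ::
    "nat \<Rightarrow> 'x set \<Rightarrow> 'y set \<Rightarrow> ('x list \<Rightarrow> bool list) \<Rightarrow> ('y list \<Rightarrow> bool list) \<Rightarrow>
     (bool list \<times> bool list \<Rightarrow> bool list) \<Rightarrow> bool list set"
  where "relay_image n \<X> \<Y> \<phi>\<^sub>A \<phi>\<^sub>B \<phi>\<^sub>C = \<phi>\<^sub>C ` (\<phi>\<^sub>A ` nlists n \<X> \<times> \<phi>\<^sub>B ` nlists n \<Y>)"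

definition relay_scheme ::
    "nat \<Rightarrow> 'x set \<Rightarrow> 'y set \<Rightarrow> 'z set \<Rightarrow>
     ('x list \<Rightarrow> bool list) \<Rightarrow> ('y list \<Rightarrow> bool list) \<Rightarrow> (bool list \<times> bool list \<Rightarrow> bool list) \<Rightarrow>
     ('x list \<times> bool list \<Rightarrow> 'z list) \<Rightarrow> ('y list \<times> bool list \<Rightarrow> 'z list) \<Rightarrow> bool"
  where "relay_scheme n \<X> \<Y> \<Z> \<phi>\<^sub>A \<phi>\<^sub>B \<phi>\<^sub>C \<psi>\<^sub>A \<psi>\<^sub>B \<longleftrightarrow>
    prefix_free (\<phi>\<^sub>A ` nlists n \<X>) \<and>
    prefix_free (\<phi>\<^sub>B ` nlists n \<Y>) \<and>
    prefix_free (relay_image n \<X> \<Y> \<phi>\<^sub>A \<phi>\<^sub>B \<phi>\<^sub>C) \<and>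
    \<psi>\<^sub>A \<in> nlists n \<X> \<times> relay_image n \<X> \<Y> \<phi>\<^sub>A \<phi>\<^sub>B \<phi>\<^sub>C \<rightarrow> nlists n \<Z> \<and>
    \<psi>\<^sub>B \<in> nlists n \<Y> \<times> relay_image n \<X> \<Y> \<phi>\<^sub>A \<phi>\<^sub>B \<phi>\<^sub>C \<rightarrow> nlists n \<Z>"

definition zero_error_scheme ::
    "nat \<Rightarrow> 'x set \<Rightarrow> 'y set \<Rightarrow> 'z set \<Rightarrow> ('x \<times> 'y \<Rightarrow> real) \<Rightarrow> ('x \<times> 'y \<Rightarrow> 'z) \<Rightarrow>
     ('x list \<Rightarrow> bool list) \<Rightarrow> ('y list \<Rightarrow> bool list) \<Rightarrow> (bool list \<times> bool list \<Rightarrow> bool list) \<Rightarrow>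
     ('x list \<times> bool list \<Rightarrow> 'z list) \<Rightarrow> ('y list \<times> bool list \<Rightarrow> 'z list) \<Rightarrow> bool"
  where "zero_error_scheme n \<X> \<Y> \<Z> p f \<phi>\<^sub>A \<phi>\<^sub>B \<phi>\<^sub>C \<psi>\<^sub>A \<psi>\<^sub>B \<longleftrightarrow>
    relay_scheme n \<X> \<Y> \<Z> \<phi>\<^sub>A \<phi>\<^sub>B \<phi>\<^sub>C \<psi>\<^sub>A \<psi>\<^sub>B \<and>
    (\<forall>xs\<in>nlists n \<X>. \<forall>ys\<in>nlists n \<Y>. \<forall>i<n. (xs ! i, ys ! i) \<in> support_set \<X> \<Y> p \<longrightarrow>
       \<psi>\<^sub>A (xs, \<phi>\<^sub>C (\<phi>\<^sub>A xs, \<phi>\<^sub>B ys)) ! i = f (xs ! i, ys ! i) \<and>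
       \<psi>\<^sub>B (ys, \<phi>\<^sub>C (\<phi>\<^sub>A xs, \<phi>\<^sub>B ys)) ! i = f (xs ! i, ys ! i))"

end

theory Submission
  imports Defs
begin

text \<open>
  On full support a word decoded at either node is exactly \<open>f\<close> applied componentwise. Node A sees only
  \<open>x\<^sup>n\<close> and a function of the pair of codewords, so \<open>f (x\<^sup>n, y\<^sup>n)\<close> does not change when
  \<open>y\<^sup>n\<close> is replaced by a word with the same codeword; symmetrically for node B. Hence the relay may
  replace both words by arbitrary preimages of the codewords.
\<close>

lemma zero_error_scheme_decodes:
  assumes scheme: "zero_error_scheme n \<X> \<Y> \<Z> p f \<phi>\<^sub>A \<phi>\<^sub>B \<phi>\<^sub>C \<psi>\<^sub>A \<psi>\<^sub>B"
    and full: "\<forall>(x, y) \<in> \<X> \<times> \<Y>. p (x, y) > 0"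
    and xs: "xs \<in> nlists n \<X>" and ys: "ys \<in> nlists n \<Y>"
  shows "\<psi>\<^sub>A (xs, \<phi>\<^sub>C (\<phi>\<^sub>A xs, \<phi>\<^sub>B ys)) = map f (zip xs ys)" (is "?a = ?w")
    and "\<psi>\<^sub>B (ys, \<phi>\<^sub>C (\<phi>\<^sub>A xs, \<phi>\<^sub>B ys)) = map f (zip xs ys)" (is "?b = ?w")
proof -
  have len: "length xs = n" "length ys = n"
    using xs ys by (simp_all add: nlistsE_length)
  have "\<phi>\<^sub>C (\<phi>\<^sub>A xs, \<phi>\<^sub>B ys) \<in> relay_image n \<X> \<Y> \<phi>\<^sub>A \<phi>\<^sub>B \<phi>\<^sub>C"
    using xs ys by (auto simp: relay_image_def)
  \<comment> \<open>The zero-error condition speaks only of single components; the codomain of the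
    decoders supplies the length \<open>n\<close>, without which equality of lists would not
    follow.\<close>
  then have "?a \<in> nlists n \<Z>" "?b \<in> nlists n \<Z>"
    using scheme xs ys by (auto simp: zero_error_scheme_def relay_scheme_def)
  then have len': "length ?a = n" "length ?b = n"
    by (simp_all add: nlistsE_length)
  \<comment> \<open>Full support enters here: no position is exempt from the zero-error
    condition.\<close>
  have "(xs ! i, ys ! i) \<in> support_set \<X> \<Y> p" if "i < n" for i
    using full xs ys that by (auto simp: support_set_def nlistsE_nth_in)
  then have "?a ! i = f (xs ! i, ys ! i) \<and> ?b ! i = f (xs ! i, ys ! i)" if "i < n" for i
    using scheme xs ys that by (auto simp: zero_error_scheme_def)
  then show "?a = ?w" "?b = ?w"
    using len len' by (auto intro!: nth_equalityI)
qed

theorem theorem2: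
  fixes M :: "'s measure"
    and X :: "'s \<Rightarrow> 'x" and Y :: "'s \<Rightarrow> 'y"
    and \<X> :: "'x set" and \<Y> :: "'y set" and \<Z> :: "'z set"
    and f :: "'x \<times> 'y \<Rightarrow> 'z"
    and n :: nat
    and \<phi>\<^sub>A :: "'x list \<Rightarrow> bool list" and \<phi>\<^sub>B :: "'y list \<Rightarrow> bool list"
    and \<phi>\<^sub>C :: "bool list \<times> bool list \<Rightarrow> bool list"
    and \<psi>\<^sub>A :: "'x list \<times> bool list \<Rightarrow> 'z list" and \<psi>\<^sub>B :: "'y list \<times> bool list \<Rightarrow> 'z list"
  assumes "finite \<X>" and "finite \<Y>"
    and "prob_space M"
    and "X \<in> measurable M (count_space \<X>)" and "Y \<in> measurable M (count_space \<Y>)"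
    and "f \<in> \<X> \<times> \<Y> \<rightarrow> \<Z>"
    and "\<forall>(x, y) \<in> \<X> \<times> \<Y>. joint_prob M X Y (x, y) > 0"
    and "zero_error_scheme n \<X> \<Y> \<Z> (joint_prob M X Y) f \<phi>\<^sub>A \<phi>\<^sub>B \<phi>\<^sub>C \<psi>\<^sub>A \<psi>\<^sub>B"
  shows "\<exists>g :: bool list \<times> bool list \<Rightarrow> 'z list.
    \<forall>xs \<in> nlists n \<X>. \<forall>ys \<in> nlists n \<Y>. g (\<phi>\<^sub>A xs, \<phi>\<^sub>B ys) = map f (zip xs ys)"
proof -
  note decodes = zero_error_scheme_decodes[OF assms(8,7)]
  \<comment> \<open>Any preimages of the two codewords serve; off the images of the encoders the
    value of \<open>g\<close> is arbitrary.\<close>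
  define g where "g = (\<lambda>(a, b).
    map f (zip (inv_into (nlists n \<X>) \<phi>\<^sub>A a) (inv_into (nlists n \<Y>) \<phi>\<^sub>B b)))"
  have "g (\<phi>\<^sub>A xs, \<phi>\<^sub>B ys) = map f (zip xs ys)"
    if xs: "xs \<in> nlists n \<X>" and ys: "ys \<in> nlists n \<Y>" for xs ys
  proof -
    define xs' where "xs' = inv_into (nlists n \<X>) \<phi>\<^sub>A (\<phi>\<^sub>A xs)"
    define ys' where "ys' = inv_into (nlists n \<Y>) \<phi>\<^sub>B (\<phi>\<^sub>B ys)"
    have xs': "xs' \<in> nlists n \<X>" "\<phi>\<^sub>A xs' = \<phi>\<^sub>A xs"
      using xs by (auto simp: xs'_def intro: inv_into_into f_inv_into_f)
    have ys': "ys' \<in> nlists n \<Y>" "\<phi>\<^sub>B ys' = \<phi>\<^sub>B ys"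
      using ys by (auto simp: ys'_def intro: inv_into_into f_inv_into_f)
    have "g (\<phi>\<^sub>A xs, \<phi>\<^sub>B ys) = map f (zip xs' ys')"
      by (simp add: g_def xs'_def ys'_def)
    \<comment> \<open>The two words are exchanged one at a time through the mixed pair
      \<open>(xs', ys)\<close>. Node A holds \<open>xs'\<close> and receives the same relay message
      for \<open>ys'\<close> and \<open>ys\<close>, so it decodes the same word.\<close>
    also have "\<dots> = map f (zip xs' ys)"
      using decodes(1)[OF xs'(1) ys'(1)] decodes(1)[OF xs'(1) ys] ys'(2) by simp
    \<comment> \<open>Now node B holds \<open>ys\<close> fixed, and the relay message is the same
      for \<open>xs'\<close> and \<open>xs\<close>.\<close>
    also have "\<dots> = map f (zip xs ys)"
      using decodes(2)[OF xs'(1) ys] decodes(2)[OF xs ys] xs'(2) by simp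
    finally show ?thesis .
  qed
  then show ?thesis by blast
qed

end
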